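(* Let $f$ satisfy Assumption 1 (stated in full in the context), with associated constants $\mu,\nu,\sigma,m$ and minimizer $w^*$ of $F(w)=\mathbf{E}_\xi[f(w,\xi)]$. Let $\{\xi^k\}_{k\in\mathbb{N}}$ be a family of jointly independent random variables on $\Omega$, each distributed as $\xi$. Let $w_1\in H$ and let $\{w^k\}_{k\in\mathbb{N}}$ be given by the stochastic proximal iteration $$w^{k+1}=w^k-\alpha_k\,\iota\nabla f(w^{k+1},\xi^k)\ \text{ in } H,\qquad w^1=w_1 .$$ If the step sizes are $\alpha_k=\frac{\eta}{k}$ with $\eta>\frac1\mu$, then the scheme converges sub-linearly; in particular, the error bound $$\mathbf{E}_{k-1}\big[\|w^k-w^*\|^2\big]\le\frac{C}{k}$$ holds for all $k\in\mathbb{N}$, where $C$ is a constant (independent of $k$) that depends on $\|w_1-w^*\|$, $\mu$, $\nu$, $\sigma$, $\eta$ and $m$.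
   Context: Setting: $(\Omega,\mathcal{F},\mathbf{P})$ is a complete probability space; $(H,(\cdot,\cdot),\|\cdot\|)$ is a real Hilbert space with dual $H^*$; $\langle u',u\rangle=u'(u)$ is the dual pairing; $\iota:H^*\to H$ is the Riesz isometric isomorphism, so $\langle u',v\rangle=(\iota u',v)$; $\mathcal{L}(H)$ is the space of bounded linear operators on $H$. $\nabla f(u,\xi)\in H^*$ denotes the Gâteaux derivative with respect to the first variable. $\mathbf{E}_\xi$ is the expectation with respect to the distribution of $\xi$. $\mathbf{E}_k[X]=\mathbf{E}_{\xi^1}[\mathbf{E}_{\xi^2}[\cdots\mathbf{E}_{\xi^k}[X]\cdots]]$ is the total expectation over $\xi^1,\dots,\xi^k$ ($\mathbf{E}_0[X]=X$); note that $w^k$ depends only on $\xi^1,\dots,\xi^{k-1}$. Assumption 1. For a random variable $\xi$ on $\Omega$, the function $f(\cdot,\xi):H\times\Omega\to(-\infty,\infty]$ is convex, lower semi-continuous and proper almost surely. Additionally: (1) $F(\cdot):=\mathbf{E}_\xi[f(\cdot,\xi)]$ is lower semi-continuous and proper. (2) $f(\cdot,\xi)$ is almost surely Gâteaux differentiable on a non-empty common domain $\mathcal{D}(\nabla f)\subseteq H$, i.e. for all $v,w\in\mathcal{D}(\nabla f)$, $\langle\nabla f(v,\xi),w\rangle=\lim_{h\to0}\frac{f(v+hw,\xi)-f(v,\xi)}{h}$ almost surely. (3) There is $m\in\mathbb{N}$ (so $m\ge1$) such that $\sigma:=\big(\mathbf{E}_\xi[\|\nabla f(w^*,\xi)\|_{H^*}^{2^m}]\big)^{2^{-m}}<\infty$.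 (4) For every $R>0$ there is $L_\xi(R):\Omega\to\mathbb{R}$ such that $\|\nabla f(u,\xi)-\nabla f(v,\xi)\|_{H^*}\le L_\xi(R)\|u-v\|$ almost surely for all $u,v\in\mathcal{D}(\nabla f)$ with $\|u\|,\|v\|\le R$. Furthermore there is a polynomial $P:\mathbb{R}\to\mathbb{R}$ of degree $2^m-2$ with $L_\xi(R)\le P(R)$ almost surely. (5) There are a random variable $M_\xi:\Omega\to\mathcal{L}(H)$ whose values are symmetric operators and a random variable $\mu_\xi:\Omega\to[0,\infty)$ with $\mathbf{E}_\xi[\mu_\xi]=\mu>0$ and $\mathbf{E}_\xi[\mu_\xi^2]=\nu^2<\infty$, such that almost surely, for all $u,v\in\mathcal{D}(\nabla f)$, $$\langle\nabla f(u,\xi)-\nabla f(v,\xi),u-v\rangle\ge(M_\xi(u-v),u-v)\ge\mu_\xi\|u-v\|^2 .$$ Here $w^*=\arg\min_{w\in H}F(w)$ is the unique minimizer of $F$ (existence and uniqueness follow from $F$ being lower semi-continuous, proper and strongly convex). As standing conventions of the paper, $w^*\in\mathcal{D}(\nabla f)$, expectation and differentiation may be interchanged, so that $\nabla F(w)=\mathbf{E}_\xi[\nabla f(w,\xi)]$ and $\mathbf{E}_\xi[\nabla f(w^*,\xi)]=\nabla F(w^* )=0$, and the iterates $w^{k+1}$, $k\ge1$, exist, are unique, and lie in $\mathcal{D}(\nabla f)$. *)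

theory Defs
  imports "HOL-Probability.Probability" "HOL-Computational_Algebra.Polynomial"
begin

text \<open>
  A real Hilbert space \<open>H\<close> is a type of sort \<open>{real_inner, complete_space}\<close>, its dual \<open>H\<^sup>*\<close> is
  the type \<open>'h \<Rightarrow>\<^sub>L real\<close> with the operator norm, and the bounded operators on \<open>H\<close> are
  \<open>'h \<Rightarrow>\<^sub>L 'h\<close>. No separability is assumed.
\<close>

text \<open>The Riesz isomorphism; existence and uniqueness of \<open>u\<close> is the representation theorem.\<close>

definition riesz :: "('h::{real_inner, complete_space} \<Rightarrow>\<^sub>L real) \<Rightarrow> 'h" where
  "riesz u' = (THE u. \<forall>v. blinfun_apply u' v = inner u v)"

definition ereal_convex :: "('h::real_vector \<Rightarrow> ereal) \<Rightarrow> bool" where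
  "ereal_convex g \<longleftrightarrow> (\<forall>u v. \<forall>t\<in>{0<..<1::real}.
     g ((1 - t) *\<^sub>R u + t *\<^sub>R v) \<le> ereal (1 - t) * g u + ereal t * g v)"

definition lower_semicontinuous :: "('h::topological_space \<Rightarrow> ereal) \<Rightarrow> bool" where
  "lower_semicontinuous g \<longleftrightarrow> (\<forall>u. g u \<le> Liminf (at u) g)"

definition proper :: "('h \<Rightarrow> ereal) \<Rightarrow> bool" where
  "proper g \<longleftrightarrow> (\<forall>u. g u \<noteq> -\<infinity>) \<and> (\<exists>u. g u \<noteq> \<infinity>)"

text \<open>
  Expectation of an extended real valued function: positive part minus negative part
  (\<open>e2ennreal\<close> truncates negative values to 0). Since \<open>\<infinity> - \<infinity> = \<infinity>\<close> in \<open>ereal\<close>, this is the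
  usual convention for integral functionals.
\<close>

definition ereal_expectation :: "'s measure \<Rightarrow> ('s \<Rightarrow> ereal) \<Rightarrow> ereal" where
  "ereal_expectation P g =
     enn2ereal (\<integral>\<^sup>+ x. e2ennreal (g x) \<partial>P) - enn2ereal (\<integral>\<^sup>+ x. e2ennreal (- g x) \<partial>P)"

text \<open>
  The directional derivative of \<open>g\<close> at \<open>v\<close> in direction \<open>w\<close> exists and is the real number \<open>c\<close>;
  by the arithmetic of \<open>ereal\<close> this forces \<open>g v\<close> to be finite.
\<close>

definition has_dir_derivative :: "('h::real_vector \<Rightarrow> ereal) \<Rightarrow> 'h \<Rightarrow> 'h \<Rightarrow> real \<Rightarrow> bool" where
  "has_dir_derivative g v w c \<longleftrightarrow>
     ((\<lambda>h::real. (g (v + h *\<^sub>R w) - g v) / ereal h) \<longlongrightarrow> ereal c) (at 0)"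

definition mean_functional :: "'s measure \<Rightarrow> ('h \<Rightarrow> 's \<Rightarrow> ereal) \<Rightarrow> 'h \<Rightarrow> ereal" where
  "mean_functional P f u = ereal_expectation P (f u)"

text \<open>
  Here \<open>P\<close> is the distribution of \<open>\<xi>\<close>, a probability measure on the space in which \<open>\<xi>\<close> takes
  its values; \<open>f u x\<close>, \<open>grad u x\<close>, \<open>L R x\<close>, \<open>Mop x\<close>, \<open>mu x\<close> stand for \<open>f(u,\<xi>)\<close>, \<open>\<nabla>f(u,\<xi>)\<close>,
  \<open>L\<^sub>\<xi>(R)\<close>, \<open>M\<^sub>\<xi>\<close>, \<open>\<mu>\<^sub>\<xi>\<close> on the event \<open>\<xi> = x\<close>. Almost sure statements and expectations are
  taken with respect to \<open>P\<close>. The point \<open>wstar\<close> is the minimizer of \<open>F\<close>, and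
  \<open>m\<close>, \<open>\<sigma>\<close>, \<open>\<mu>\<close>, \<open>\<nu>\<close> are the constants of the assumption.
\<close>

definition assumption1 ::
  "'s measure \<Rightarrow> ('h::{real_inner, complete_space} \<Rightarrow> 's \<Rightarrow> ereal) \<Rightarrow>
   ('h \<Rightarrow> 's \<Rightarrow> ('h \<Rightarrow>\<^sub>L real)) \<Rightarrow> 'h set \<Rightarrow> 'h \<Rightarrow> nat \<Rightarrow> real \<Rightarrow> real \<Rightarrow> real \<Rightarrow> bool" where
  "assumption1 P f grad D wstar m \<sigma> \<mu> \<nu> \<longleftrightarrow>
     (\<forall>u. f u \<in> borel_measurable P) \<and>
     (\<forall>u. \<forall>x\<in>space P. f u x \<noteq> -\<infinity>) \<and>
     (AE x in P. ereal_convex (\<lambda>u. f u x) \<and> lower_semicontinuous (\<lambda>u. f u x) \<and>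
        proper (\<lambda>u. f u x)) \<and>
     lower_semicontinuous (mean_functional P f) \<and> proper (mean_functional P f) \<and>
     D \<noteq> {} \<and>
     (\<forall>v\<in>D. grad v \<in> borel_measurable P) \<and>
     (\<forall>v\<in>D. \<forall>w\<in>D. AE x in P.
        has_dir_derivative (\<lambda>u. f u x) v w (blinfun_apply (grad v x) w)) \<and>
     1 \<le> m \<and>
     integrable P (\<lambda>x. norm (grad wstar x) ^ (2 ^ m)) \<and>
     \<sigma> = (\<integral>x. norm (grad wstar x) ^ (2 ^ m) \<partial>P) powr (1 / 2 ^ m) \<and>
     (\<exists>(L :: real \<Rightarrow> 's \<Rightarrow> real) (p :: real poly).
        degree p = 2 ^ m - 2 \<and>
        (\<forall>R>0. AE x in P. \<forall>u\<in>D. \<forall>v\<in>D. norm u \<le> R \<longrightarrow> norm v \<le> R \<longrightarrow>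
           norm (grad u x - grad v x) \<le> L R x * norm (u - v)) \<and>
        (\<forall>R>0. AE x in P. L R x \<le> poly p R)) \<and>
     (\<exists>(Mop :: 's \<Rightarrow> ('h \<Rightarrow>\<^sub>L 'h)) (mu :: 's \<Rightarrow> real).
        Mop \<in> borel_measurable P \<and>
        (\<forall>x\<in>space P. \<forall>u v.
           inner (blinfun_apply (Mop x) u) v = inner u (blinfun_apply (Mop x) v)) \<and>
        mu \<in> borel_measurable P \<and> (\<forall>x\<in>space P. 0 \<le> mu x) \<and>
        integrable P mu \<and> (\<integral>x. mu x \<partial>P) = \<mu> \<and> 0 < \<mu> \<and>
        integrable P (\<lambda>x. (mu x)\<^sup>2) \<and> (\<integral>x. (mu x)\<^sup>2 \<partial>P) = \<nu>\<^sup>2 \<and>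
        (AE x in P. \<forall>u\<in>D. \<forall>v\<in>D.
           blinfun_apply (grad u x - grad v x) (u - v)
             \<ge> inner (blinfun_apply (Mop x) (u - v)) (u - v) \<and>
           inner (blinfun_apply (Mop x) (u - v)) (u - v) \<ge> mu x * (norm (u - v))\<^sup>2))"

text \<open>
  The minimizer lies in \<open>D\<close>, and \<open>\<nabla>F(u) = E[\<nabla>f(u,\<xi>)]\<close> on \<open>D\<close> with \<open>\<nabla>F(wstar) = 0\<close>. The
  expectation in \<open>H\<^sup>*\<close> is expressed through its action on every \<open>v\<close> (the library's Bochner integral
  needs a separable target space); this is implied by the Bochner integral identity.
  Uniqueness of the minimizer follows from the strong convexity and is not assumed.
\<close>

definition minimizer_conventions ::
  "'s measure \<Rightarrow> ('h::{real_inner, complete_space} \<Rightarrow> 's \<Rightarrow> ereal) \<Rightarrow>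
   ('h \<Rightarrow> 's \<Rightarrow> ('h \<Rightarrow>\<^sub>L real)) \<Rightarrow> 'h set \<Rightarrow> 'h \<Rightarrow> bool" where
  "minimizer_conventions P f grad D wstar \<longleftrightarrow>
     is_arg_min (mean_functional P f) (\<lambda>_. True) wstar \<and>
     wstar \<in> D \<and>
     (\<exists>gradF :: 'h \<Rightarrow> ('h \<Rightarrow>\<^sub>L real).
        (\<forall>v\<in>D. \<forall>w\<in>D.
           has_dir_derivative (mean_functional P f) v w (blinfun_apply (gradF v) w)) \<and>
        (\<forall>u\<in>D. \<forall>v. integrable P (\<lambda>x. blinfun_apply (grad u x) v) \<and>
           blinfun_apply (gradF u) v = (\<integral>x. blinfun_apply (grad u x) v \<partial>P)) \<and>
        gradF wstar = 0)"

definition joint_law :: "'w measure \<Rightarrow> 's measure \<Rightarrow> (nat \<Rightarrow> 'w \<Rightarrow> 's) \<Rightarrow> nat \<Rightarrow> (nat \<Rightarrow> 's) measure"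
  where
  "joint_law M N \<xi>s k = distr M (PiM {1..k} (\<lambda>_. N)) (\<lambda>\<omega>. \<lambda>i\<in>{1..k}. \<xi>s i \<omega>)"

text \<open>
  The iterate \<open>w\<^sup>k\<close> is a random variable that depends only on \<open>\<xi>\<^sup>1, \<dots>, \<xi>\<^sup>k\<^sup>-\<^sup>1\<close>. It is rendered as a
  measurable function \<open>w k\<close> on the sample space of \<open>(\<xi>\<^sup>1, \<dots>, \<xi>\<^sup>k\<^sup>-\<^sup>1)\<close>, so that the actual iterate on
  the probability space is \<open>\<lambda>\<omega>. w k (\<lambda>i\<in>{1..<k}. \<xi>s i \<omega>)\<close>. The implicit recursion holds almost
  surely in the joint distribution of \<open>(\<xi>\<^sup>1, \<dots>, \<xi>\<^sup>k)\<close>. The index 0 is not used.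
\<close>

definition stochastic_proximal_iteration ::
  "'w measure \<Rightarrow> 's measure \<Rightarrow> (nat \<Rightarrow> 'w \<Rightarrow> 's) \<Rightarrow>
   ('h::{real_inner, complete_space} \<Rightarrow> 's \<Rightarrow> ('h \<Rightarrow>\<^sub>L real)) \<Rightarrow> 'h set \<Rightarrow>
   (nat \<Rightarrow> real) \<Rightarrow> 'h \<Rightarrow> (nat \<Rightarrow> (nat \<Rightarrow> 's) \<Rightarrow> 'h) \<Rightarrow> bool" where
  "stochastic_proximal_iteration M N \<xi>s grad D \<alpha> w1 w \<longleftrightarrow>
     (\<forall>k\<ge>1. w k \<in> borel_measurable (PiM {1..<k} (\<lambda>_. N))) \<and>
     (\<forall>s \<in> space (PiM {1..<1} (\<lambda>_. N)). w 1 s = w1) \<and>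
     (\<forall>k\<ge>1. AE s in joint_law M N \<xi>s k.
        w (Suc k) s \<in> D \<and>
        w (Suc k) s = w k (restrict s {1..<k}) - \<alpha> k *\<^sub>R riesz (grad (w (Suc k) s) (s k)))"

text \<open>
  The total expectation \<open>E\<^sub>k[X] = E[E[\<dots>E[X]\<dots>]]\<close>, with the expectation over \<open>\<xi>\<^sup>k\<close> innermost, of a
  nonnegative \<open>X\<close> that depends on \<open>\<xi>\<^sup>1, \<dots>, \<xi>\<^sup>k\<close>, each of these having distribution \<open>P\<close>.
  The coordinates outside \<open>{1..k}\<close> keep the value \<open>undefined\<close>, as in \<open>PiM\<close>. The value \<open>\<infinity>\<close> is
  possible, so an upper bound by a real number includes integrability.
\<close>

primrec total_expectation :: "'s measure \<Rightarrow> nat \<Rightarrow> ((nat \<Rightarrow> 's) \<Rightarrow> ennreal) \<Rightarrow> ennreal" where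
  "total_expectation P 0 X = X (\<lambda>_. undefined)"
| "total_expectation P (Suc k) X =
     total_expectation P k (\<lambda>s. \<integral>\<^sup>+ x. X (s(Suc k := x)) \<partial>P)"

end

theory Submission
  imports Defs
begin

text \<open>
  Write \<open>e\<close> and \<open>e'\<close> for the errors before and after a step and \<open>g = \<iota>\<nabla>f(wstar, \<xi>)\<close>. Monotonicity
  gives \<open>(1 + \<alpha> \<mu>\<^sub>\<xi>) \<parallel>e'\<parallel> \<le> \<parallel>e - \<alpha> g\<parallel>\<close>. Dividing, squaring and expanding to second order in \<open>\<alpha>\<close>
  leaves the cross term \<open>-2 \<alpha> (g, e)\<close>, whose expectation vanishes, so that
  \<open>E\<parallel>e'\<parallel>\<^sup>2 \<le> (1 - 2 \<alpha> \<mu> + 5 \<alpha>\<^sup>2 \<nu>\<^sup>2) E\<parallel>e\<parallel>\<^sup>2 + 3 \<alpha>\<^sup>2 \<sigma>\<^sup>2\<close>. For \<open>\<alpha> = \<eta> / k\<close> with \<open>\<eta> \<mu> > 1\<close>, this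
  recursion propagates a bound \<open>C / k\<close> as soon as \<open>k \<ge> 5 \<eta>\<^sup>2 \<nu>\<^sup>2\<close>; the finitely many earlier
  errors are absorbed in \<open>C\<close>.
\<close>

section \<open>Riesz representation in a Hilbert space\<close>

lemma parallelogram_law:
  fixes a b :: "'h::real_inner"
  shows "(norm (a + b))\<^sup>2 + (norm (a - b))\<^sup>2 = 2 * (norm a)\<^sup>2 + 2 * (norm b)\<^sup>2"
  by (simp add: power2_norm_eq_inner inner_add inner_diff inner_commute)

text \<open>Direct method: the functional \<open>J\<close> is bounded below by completing the
  square, and the parallelogram law makes a minimizing sequence Cauchy. Completeness gives a
  minimizer, whose first order condition is the representation of \<open>\<phi>\<close>.\<close>

lemma riesz_representation:
  fixes \<phi> :: "'h::{real_inner, complete_space} \<Rightarrow>\<^sub>L real"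
  shows "\<exists>u. \<forall>v. blinfun_apply \<phi> v = inner u v"
proof -
  define J where "J u = (norm u)\<^sup>2 - 2 * blinfun_apply \<phi> u" for u
  define I where "I = Inf (range J)"
  have "- (norm \<phi>)\<^sup>2 \<le> J u" for u
  proof -
    have "blinfun_apply \<phi> u \<le> norm \<phi> * norm u"
      using norm_blinfun[of \<phi> u] by simp
    moreover have "0 \<le> (norm u - norm \<phi>)\<^sup>2" by simp
    ultimately show ?thesis unfolding J_def power2_diff by argo
  qed
  then have bdd: "bdd_below (range J)" by (rule bdd_belowI2)
  have I_le: "I \<le> J u" for u
    unfolding I_def by (rule cInf_lower[OF _ bdd]) simp
  have "\<exists>u. J u < I + 1 / real (Suc n)" for n
    using cInf_lessD[of "range J" "I + 1 / real (Suc n)"] unfolding I_def by auto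
  \<comment> \<open>a minimizing sequence of the quadratic functional; its limit represents \<open>\<phi>\<close>\<close>
  then obtain u where u: "J (u n) < I + 1 / real (Suc n)" for n by metis
  \<comment> \<open>The parallelogram law at the midpoint of \<open>a\<close> and \<open>b\<close>,
    where \<open>J\<close> is still at least \<open>I\<close>: near-minimizers lie close
    together.\<close>
  have close: "(norm (a - b))\<^sup>2 \<le> 2 * (J a - I) + 2 * (J b - I)" for a b
  proof -
    have "blinfun_apply \<phi> ((1/2) *\<^sub>R (a + b)) = (blinfun_apply \<phi> a + blinfun_apply \<phi> b) / 2"
      by (simp add: blinfun.scaleR_right blinfun.add_right del: scaleR_add_right)
    moreover have "(norm ((1/2) *\<^sub>R (a + b)))\<^sup>2 = (norm (a + b))\<^sup>2 / 4"
      by (simp add: power_divide del: scaleR_add_right)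
    ultimately have "J ((1/2) *\<^sub>R (a + b))
        = (norm (a + b))\<^sup>2 / 4 - blinfun_apply \<phi> a - blinfun_apply \<phi> b"
      by (simp add: J_def del: scaleR_add_right)
    with I_le[of "(1/2) *\<^sub>R (a + b)"] parallelogram_law[of a b] show ?thesis
      unfolding J_def by simp
  qed
  have "Cauchy u"
  proof (rule metric_CauchyI)
    fix e :: real assume "0 < e"
    then obtain n where n: "1 / real (Suc n) < e\<^sup>2 / 4"
      using nat_approx_posE[of "e\<^sup>2 / 4"] by auto
    have "dist (u i) (u j) < e" if "n \<le> i" "n \<le> j" for i j
    proof -
      have "1 / real (Suc i) \<le> 1 / real (Suc n)" "1 / real (Suc j) \<le> 1 / real (Suc n)"
        using that by (auto intro!: divide_left_mono)
      with u[of i] u[of j] n close[of "u i" "u j"]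
      have "(norm (u i - u j))\<^sup>2 < e\<^sup>2" by argo
      then show ?thesis using \<open>0 < e\<close> power_less_imp_less_base[of "norm (u i - u j)" 2 e]
        by (simp add: dist_norm)
    qed
    then show "\<exists>M. \<forall>m\<ge>M. \<forall>n\<ge>M. dist (u m) (u n) < e" by blast
  qed
  then obtain l where l: "u \<longlonglongrightarrow> l"
    using Cauchy_convergent convergent_def by blast
  have "(\<lambda>n. J (u n)) \<longlonglongrightarrow> J l"
    unfolding J_def by (intro tendsto_intros l)
  moreover have "(\<lambda>n. I + 1 / real (Suc n)) \<longlonglongrightarrow> I"
    using tendsto_add[OF tendsto_const[of I] LIMSEQ_inverse_real_of_nat]
    by (simp add: inverse_eq_divide)
  ultimately have "J l \<le> I"
    by (rule LIMSEQ_le) (use u less_imp_le in blast)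
  then have min: "J l \<le> J v" for v using I_le[of v] by simp
  have "blinfun_apply \<phi> v = inner l v" for v
  proof -
    define c where "c = inner l v - blinfun_apply \<phi> v"
    have q: "0 \<le> t\<^sup>2 * (norm v)\<^sup>2 + 2 * t * c" for t
    proof -
      have "J (l + t *\<^sub>R v) = J l + t\<^sup>2 * (norm v)\<^sup>2 + 2 * t * c"
        unfolding J_def c_def power2_norm_eq_inner
        by (simp add: blinfun.add_right blinfun.scaleR_right inner_add inner_commute
            algebra_simps power2_eq_square)
      with min[of "l + t *\<^sub>R v"] show ?thesis by simp
    qed
    \<comment> \<open>The parameter \<open>t = - c / K\<close> nearly minimizes the quadratic in
      \<open>q\<close>; the summand 1 keeps \<open>K\<close> positive when
      \<open>v = 0\<close>.\<close>
    define K where "K = 1 + (norm v)\<^sup>2"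
    have "K > 0" by (simp add: K_def add_pos_nonneg)
    have "0 \<le> (c / K)\<^sup>2 * (norm v)\<^sup>2 - 2 * c\<^sup>2 / K"
      using q[of "- c / K"] by (simp add: power2_eq_square)
    also have "\<dots> \<le> (c / K)\<^sup>2 * K - 2 * c\<^sup>2 / K"
      by (simp add: K_def mult_left_mono)
    also have "\<dots> = - (c\<^sup>2 / K)"
      using \<open>K > 0\<close> by (simp add: power2_eq_square field_simps)
    finally have "c = 0" using \<open>K > 0\<close> by (simp add: divide_le_0_iff)
    then show ?thesis by (simp add: c_def)
  qed
  then show ?thesis by blast
qed

lemma inner_riesz:
  fixes \<phi> :: "'h::{real_inner, complete_space} \<Rightarrow>\<^sub>L real"
  shows "inner (riesz \<phi>) v = blinfun_apply \<phi> v"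
proof -
  obtain u where u: "\<forall>v. blinfun_apply \<phi> v = inner u v"
    using riesz_representation by blast
  have "riesz \<phi> = u"
    unfolding riesz_def
  proof (rule the_equality)
    show "\<forall>v. blinfun_apply \<phi> v = inner u v" by (rule u)
  next
    fix u' assume "\<forall>v. blinfun_apply \<phi> v = inner u' v"
    with u have "inner (u' - u) v = 0" for v by (simp add: inner_diff)
    then show "u' = u" using inner_eq_zero_iff[of "u' - u"] by simp
  qed
  with u show ?thesis by simp
qed

lemma norm_riesz_le: "norm (riesz \<phi>) \<le> norm \<phi>"
  for \<phi> :: "'h::{real_inner, complete_space} \<Rightarrow>\<^sub>L real"
proof (cases "riesz \<phi> = 0")
  case False
  have "norm (riesz \<phi>) * norm (riesz \<phi>) \<le> norm \<phi> * norm (riesz \<phi>)"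
    using inner_riesz[of \<phi> "riesz \<phi>"] norm_blinfun[of \<phi> "riesz \<phi>"]
    by (simp flip: power2_norm_eq_inner add: power2_eq_square)
  with False show ?thesis by simp
qed simp

lemma riesz_diff: "riesz (\<phi> - \<psi>) = riesz \<phi> - riesz \<psi>"
proof -
  have "inner (riesz (\<phi> - \<psi>) - (riesz \<phi> - riesz \<psi>)) v = 0" for v
    by (simp add: inner_diff inner_riesz blinfun.diff_left)
  then show ?thesis
    using inner_eq_zero_iff[of "riesz (\<phi> - \<psi>) - (riesz \<phi> - riesz \<psi>)"] by simp
qed

section \<open>Pathwise estimate for one implicit step\<close>

text \<open>The correlation between the random modulus \<open>c\<close> and the noise \<open>g\<close> costs only second order in
  the step size: the factor \<open>(1 + \<alpha> c)\<^sup>-\<^sup>2\<close> in front of the noise differs from 1 by at most \<open>2 \<alpha> c\<close>,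
  so that the first order term \<open>inner g e\<close> keeps the coefficient it has without the factor.\<close>

lemma implicit_step_bound:
  fixes e e' d g :: "'h::real_inner"
  assumes step: "e' = e - \<alpha> *\<^sub>R (d + g)" and mono: "c * (norm e')\<^sup>2 \<le> inner d e'"
    and "0 \<le> c" "0 \<le> \<alpha>"
  shows "(norm e')\<^sup>2 \<le> (1 - 2 * (\<alpha> * c) + 5 * (\<alpha> * c)\<^sup>2) * (norm e)\<^sup>2 - 2 * \<alpha> * inner g e
           + 3 * \<alpha>\<^sup>2 * (norm g)\<^sup>2"
proof -
  define x where "x = \<alpha> * c"
  define y where "y = e - \<alpha> *\<^sub>R g"
  define \<phi> where "\<phi> = 1 / (1 + x)\<^sup>2"
  have x: "0 \<le> x" using assms by (simp add: x_def)
  then have "1 \<le> (1 + x)\<^sup>2" by simp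
  have \<phi>1: "0 \<le> \<phi>" "\<phi> \<le> 1" using \<open>1 \<le> (1 + x)\<^sup>2\<close> by (auto simp: \<phi>_def divide_le_eq)
  \<comment> \<open>This bound and the next compare \<open>(1 + x)^-2\<close> with its Taylor
    polynomials at 0; both are checked by multiplying out with \<open>(1 + x)^2\<close>.\<close>
  have \<phi>_lower: "1 - \<phi> \<le> 2 * x"
  proof -
    have "(1 - 2 * x) * (1 + x)\<^sup>2 = 1 - x\<^sup>2 * (3 + 2 * x)"
      by (simp add: power2_eq_square algebra_simps)
    then have "(1 - 2 * x) * (1 + x)\<^sup>2 \<le> 1" using x by simp
    then show ?thesis using x by (simp add: \<phi>_def field_simps)
  qed
  have \<phi>_upper: "\<phi> \<le> 1 - 2 * x + 3 * x\<^sup>2"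
  proof -
    have "(1 - 2 * x + 3 * x\<^sup>2) * (1 + x)\<^sup>2 = 1 + x ^ 3 * (4 + 3 * x)"
      by (simp add: power2_eq_square power3_eq_cube algebra_simps)
    then have "1 \<le> (1 - 2 * x + 3 * x\<^sup>2) * (1 + x)\<^sup>2" using x by simp
    then show ?thesis using x by (simp add: \<phi>_def pos_divide_le_eq)
  qed
  \<comment> \<open>Here \<open>y\<close> carries the explicit noise and \<open>d\<close> the
    implicit part, so testing against \<open>e'\<close> brings in the monotonicity
    hypothesis.\<close>
  have "y = e' + \<alpha> *\<^sub>R d" by (simp add: y_def step scaleR_add_right)
  then have "inner y e' = (norm e')\<^sup>2 + \<alpha> * inner d e'"
    by (simp add: inner_add power2_norm_eq_inner)
  then have "(1 + x) * (norm e')\<^sup>2 \<le> inner y e'"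
    using mult_left_mono[OF mono \<open>0 \<le> \<alpha>\<close>] by (simp add: x_def algebra_simps)
  also have "\<dots> \<le> norm y * norm e'" by (rule norm_cauchy_schwarz)
  finally have "(1 + x) * norm e' \<le> norm y"
    by (cases "e' = 0") (auto simp: power2_eq_square)
  then have "((1 + x) * norm e')\<^sup>2 \<le> (norm y)\<^sup>2"
    using x by (intro power_mono) auto
  then have "(norm e')\<^sup>2 \<le> \<phi> * (norm y)\<^sup>2"
    using x by (simp add: \<phi>_def power_mult_distrib le_divide_eq mult.commute)
  also have "(norm y)\<^sup>2 = (norm e)\<^sup>2 - 2 * \<alpha> * inner g e + \<alpha>\<^sup>2 * (norm g)\<^sup>2"
    unfolding y_def power2_norm_eq_inner
    by (simp add: inner_diff inner_commute power2_eq_square algebra_simps)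
  also have "\<phi> * \<dots> = \<phi> * (norm e)\<^sup>2 - 2 * \<alpha> * inner g e + 2 * \<alpha> * (1 - \<phi>) * inner g e
      + \<phi> * (\<alpha>\<^sup>2 * (norm g)\<^sup>2)"
    by (simp add: algebra_simps)
  \<comment> \<open>The surplus cross term is at most \<open>4 \<alpha>^2 c \<parallel>g\<parallel>
    \<parallel>e\<parallel>\<close>. Splitting it by \<open>2ab \<le> a^2 + b^2\<close> raises the
    coefficient 3 of \<open>x^2\<close> to 5 and the coefficient 1 of
    \<open>\<alpha>^2 \<parallel>g\<parallel>^2\<close> to 3.\<close>
  also have "\<dots> \<le> (1 - 2 * x + 3 * x\<^sup>2) * (norm e)\<^sup>2 - 2 * \<alpha> * inner g e
      + 2 * \<alpha>\<^sup>2 * (c\<^sup>2 * (norm e)\<^sup>2 + (norm g)\<^sup>2) + 1 * (\<alpha>\<^sup>2 * (norm g)\<^sup>2)"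
  proof -
    have "2 * \<alpha> * (1 - \<phi>) * inner g e \<le> 2 * \<alpha> * (1 - \<phi>) * (norm g * norm e)"
      using \<phi>1 \<open>0 \<le> \<alpha>\<close> by (intro mult_left_mono norm_cauchy_schwarz) auto
    also have "\<dots> \<le> 2 * \<alpha> * (2 * x) * (norm g * norm e)"
      using \<phi>_lower \<open>0 \<le> \<alpha>\<close> by (intro mult_left_mono mult_right_mono) auto
    also have "\<dots> = 2 * \<alpha>\<^sup>2 * (2 * (c * norm e) * norm g)"
      by (simp add: x_def power2_eq_square)
    also have "\<dots> \<le> 2 * \<alpha>\<^sup>2 * ((c * norm e)\<^sup>2 + (norm g)\<^sup>2)"
      using sum_squares_bound[of "c * norm e" "norm g"] by (intro mult_left_mono) auto
    finally have "2 * \<alpha> * (1 - \<phi>) * inner g e \<le> 2 * \<alpha>\<^sup>2 * (c\<^sup>2 * (norm e)\<^sup>2 + (norm g)\<^sup>2)"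
      by (simp add: power_mult_distrib)
    moreover have "\<phi> * (norm e)\<^sup>2 \<le> (1 - 2 * x + 3 * x\<^sup>2) * (norm e)\<^sup>2"
      using \<phi>_upper by (rule mult_right_mono) simp
    moreover have "\<phi> * (\<alpha>\<^sup>2 * (norm g)\<^sup>2) \<le> 1 * (\<alpha>\<^sup>2 * (norm g)\<^sup>2)"
      using \<phi>1(2) by (rule mult_right_mono) simp
    ultimately show ?thesis by linarith
  qed
  finally show ?thesis by (simp add: x_def power_mult_distrib algebra_simps)
qed

section \<open>The deterministic recursion and its rate\<close>

text \<open>From the threshold \<open>K \<ge> A\<close> on, the recursion contracts fast enough.
  Before it, the errors are bounded by iterating the worst-case step
  \<open>t \<mapsto> (1 + A) t + B\<close>, and the factor \<open>K\<close> turns this into a bound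
  of the form \<open>C / k\<close>. The last summand ensures \<open>B \<le> (2c - 2) C\<close>,
  which closes the induction beyond \<open>K\<close>.\<close>

definition rate_constant :: "real \<Rightarrow> real \<Rightarrow> real \<Rightarrow> real \<Rightarrow> real" where
  "rate_constant c A B b = (let K = Suc (nat \<lceil>A\<rceil>) in
     real K * ((\<lambda>t. (1 + A) * t + B) ^^ K) b + B / (2 * c - 2))"

text \<open>Up to \<open>K\<close> a crude growth bound suffices. Beyond \<open>K\<close>,
  \<open>A / k^2 \<le> 1 / k\<close> reduces the factor to \<open>1 - (2c - 1) / k\<close>, so that
  \<open>C / k\<close> is mapped below \<open>C / k - C / k^2 \<le> C / (k + 1)\<close>. The
  hypothesis \<open>coeff\<close> allows the induction hypothesis to be multiplied by the
  factor.\<close>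

lemma recursion_rate:
  fixes b :: "nat \<Rightarrow> real"
  assumes "1 < c" "0 \<le> A" "0 \<le> B" and nonneg: "\<And>k. 1 \<le> k \<Longrightarrow> 0 \<le> b k"
    and coeff: "\<And>k::nat. 1 \<le> k \<Longrightarrow> 0 \<le> 1 - 2 * c / k + A / k\<^sup>2"
    and rec: "\<And>k. 1 \<le> k \<Longrightarrow> b (Suc k) \<le> (1 - 2 * c / k + A / k\<^sup>2) * b k + B / k\<^sup>2"
    and "1 \<le> k"
  shows "b k \<le> rate_constant c A B (b 1) / k"
proof -
  define K where "K = Suc (nat \<lceil>A\<rceil>)"
  define h where "h t = (1 + A) * t + B" for t
  define C where "C = rate_constant c A B (b 1)"
  have C: "C = real K * (h ^^ K) (b 1) + B / (2 * c - 2)"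
    unfolding C_def rate_constant_def K_def h_def[abs_def] by (simp add: Let_def)
  have h_ge: "t \<le> h t" if "0 \<le> t" for t
    using that assms(2,3) mult_nonneg_nonneg[of A t] unfolding h_def by (simp add: algebra_simps)
  have pos: "0 \<le> (h ^^ n) (b 1)" for n
    by (induction n) (use nonneg[of 1] h_ge order_trans in \<open>auto\<close>)
  have mono: "(h ^^ i) (b 1) \<le> (h ^^ j) (b 1)" if "i \<le> j" for i j
    using that h_ge[OF pos] lift_Suc_mono_le[of "\<lambda>n. (h ^^ n) (b 1)" i j] by simp
  have "K \<ge> 1" "A \<le> K" by (auto simp: K_def) linarith
  have "0 \<le> B / (2 * c - 2)" using assms by simp
  \<comment> \<open>Only \<open>k - 1\<close> steps lead from \<open>b 1\<close> to
    \<open>b k\<close>; the extra application of \<open>h\<close> is harmless because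
    \<open>h\<close> does not decrease nonnegative numbers.\<close>
  have crude: "b k \<le> (h ^^ k) (b 1)" if "1 \<le> k" for k
    using that
  proof (induction k rule: dec_induct)
    case base
    show ?case using h_ge[of "b 1"] nonneg[of 1] by simp
  next
    case (step n)
    have "1 - 2 * c / n + A / n\<^sup>2 \<le> 1 + A" "B / n\<^sup>2 \<le> B"
    proof -
      have "1 \<le> (real n)\<^sup>2" using step by simp
      then have "A / n\<^sup>2 \<le> A / 1" "B / n\<^sup>2 \<le> B / 1"
        using assms(2,3) step by (intro divide_left_mono; simp)+
      moreover have "0 \<le> 2 * c / n" using assms by simp
      ultimately show "1 - 2 * c / n + A / n\<^sup>2 \<le> 1 + A" "B / n\<^sup>2 \<le> B" by auto
    qed
    then have "b (Suc n) \<le> (1 + A) * b n + B"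
      using rec[of n] nonneg[of n] step
        mult_right_mono[of "1 - 2 * c / n + A / n\<^sup>2" "1 + A" "b n"] by simp
    also have "\<dots> \<le> h ((h ^^ n) (b 1))"
      unfolding h_def[of "(h ^^ n) (b 1)"] using step assms(2) by (simp add: mult_left_mono)
    finally show ?case by simp
  qed
  show "b k \<le> C / k"
  proof (cases "k \<le> K")
    case True
    have "b k \<le> (h ^^ K) (b 1)" using crude[OF \<open>1 \<le> k\<close>] mono[OF True] by simp
    then have "k * b k \<le> K * (h ^^ K) (b 1)"
      using True nonneg[OF \<open>1 \<le> k\<close>] by (intro mult_mono) auto
    also have "\<dots> \<le> C" using \<open>0 \<le> B / (2 * c - 2)\<close> by (simp add: C)
    finally show ?thesis using \<open>1 \<le> k\<close> by (simp add: field_simps)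
  next
    case False
    then have "K \<le> k" by simp
    then show ?thesis
    proof (induction k rule: dec_induct)
      case base
      have "K * b K \<le> K * (h ^^ K) (b 1)"
        using crude[OF \<open>1 \<le> K\<close>] by (simp add: mult_left_mono)
      also have "\<dots> \<le> C" using \<open>0 \<le> B / (2 * c - 2)\<close> by (simp add: C)
      finally show ?case using \<open>1 \<le> K\<close> by (simp add: field_simps)
    next
      case (step n)
      have n: "1 \<le> n" "A \<le> n" using step \<open>1 \<le> K\<close> \<open>A \<le> K\<close> by auto
      have "0 \<le> C" using pos[of K] \<open>0 \<le> B / (2 * c - 2)\<close> by (simp add: C)
      have "B / (2 * c - 2) \<le> C" using pos[of K] by (simp add: C)
      \<comment> \<open>Of the gain \<open>(2c - 1) C\<close>, one part absorbs the noise
        \<open>B\<close> and a full \<open>C\<close> remains for passing from \<open>C / n\<close>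
        to \<open>C / (n + 1)\<close>.\<close>
      then have CB: "B + C \<le> (2 * c - 1) * C" using assms(1) by (simp add: field_simps)
      have "A / n\<^sup>2 \<le> 1 / n"
        using n by (simp add: field_simps power2_eq_square mult_left_mono)
      then have le: "1 - 2 * c / n + A / n\<^sup>2 \<le> 1 - (2 * c - 1) / n"
        by (simp add: diff_divide_distrib)
      have "b (Suc n) \<le> (1 - 2 * c / n + A / n\<^sup>2) * (C / n) + B / n\<^sup>2"
        using rec[OF n(1)] mult_left_mono[OF step.IH coeff[OF n(1)]] by simp
      also have "\<dots> \<le> (1 - (2 * c - 1) / n) * (C / n) + B / n\<^sup>2"
        using mult_right_mono[OF le, of "C / n"] \<open>0 \<le> C\<close> by simp
      also have "\<dots> = C / n - ((2 * c - 1) * C - B) / n\<^sup>2"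
        using n by (simp add: field_simps power2_eq_square)
      also have "\<dots> \<le> C / n - C / n\<^sup>2"
        using CB by (simp add: divide_right_mono)
      also have "\<dots> \<le> C / Suc n"
      proof -
        have "C * ((real n - 1) * (real n + 1)) \<le> C * (real n)\<^sup>2"
          using \<open>0 \<le> C\<close> by (intro mult_left_mono) (simp add: power2_eq_square algebra_simps)
        then have "C * (real n - 1) / (real n)\<^sup>2 \<le> C / (real n + 1)"
          using n by (simp add: divide_le_eq mult.assoc le_divide_eq)
        moreover have "C / n - C / n\<^sup>2 = C * (real n - 1) / (real n)\<^sup>2"
          using n by (simp add: field_simps power2_eq_square)
        ultimately show ?thesis by (simp add: add.commute)
      qed
      finally show ?case .
    qed
  qed
qed

section \<open>Moment inequalities\<close>

text \<open>Jensen's inequality for exponents that are powers of two: each doubling of the exponent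
  is one use of the nonnegativity of the variance.\<close>

lemma (in prob_space) power_expectation_le:
  fixes Y :: "'a \<Rightarrow> real"
  assumes "Y \<in> borel_measurable M" "\<And>x. 0 \<le> Y x" "integrable M (\<lambda>x. Y x ^ (2 ^ j))"
  shows "integrable M Y" "expectation Y ^ (2 ^ j) \<le> expectation (\<lambda>x. Y x ^ (2 ^ j))"
proof -
  have "integrable M Y \<and> expectation Y ^ (2 ^ j) \<le> expectation (\<lambda>x. Y x ^ (2 ^ j))"
    using assms
  proof (induction j arbitrary: Y)
    case 0
    then show ?case by simp
  next
    case (Suc j)
    note [measurable] = Suc.prems(1)
    have pow: "Y x ^ (2 ^ Suc j) = (Y x)\<^sup>2 ^ (2 ^ j)" for x
      by (simp add: power_mult)
    have IH: "integrable M (\<lambda>x. (Y x)\<^sup>2)"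
      "expectation (\<lambda>x. (Y x)\<^sup>2) ^ (2 ^ j) \<le> expectation (\<lambda>x. Y x ^ (2 ^ Suc j))"
      using Suc.IH[of "\<lambda>x. (Y x)\<^sup>2"] Suc.prems(3) unfolding pow by auto
    then have int: "integrable M Y"
      using square_integrable_imp_integrable Suc.prems(1) by blast
    have "0 \<le> variance Y" by (rule variance_positive)
    then have "(expectation Y)\<^sup>2 \<le> expectation (\<lambda>x. (Y x)\<^sup>2)"
      using variance_eq[OF int IH(1)] by simp
    then have "((expectation Y)\<^sup>2) ^ (2 ^ j) \<le> expectation (\<lambda>x. (Y x)\<^sup>2) ^ (2 ^ j)"
      by (intro power_mono) auto
    also have "((expectation Y)\<^sup>2) ^ (2 ^ j) = expectation Y ^ (2 ^ Suc j)"
      by (simp add: power_mult)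
    finally show ?case using IH(2) int by (blast intro: order_trans)
  qed
  then show "integrable M Y" "expectation Y ^ (2 ^ j) \<le> expectation (\<lambda>x. Y x ^ (2 ^ j))"
    by auto
qed

text \<open>Controls the noise by \<open>\<sigma>\<close>, a norm of order \<open>2^m\<close>: the
  previous lemma is applied to \<open>X^2\<close> with exponent \<open>2^(m-1)\<close>, and the root
  is then extracted.\<close>

lemma (in prob_space) second_moment_le:
  fixes X :: "'a \<Rightarrow> real"
  assumes meas: "X \<in> borel_measurable M" and "1 \<le> m" and int: "integrable M (\<lambda>x. X x ^ (2 ^ m))"
  shows "integrable M (\<lambda>x. (X x)\<^sup>2)"
    "expectation (\<lambda>x. (X x)\<^sup>2) \<le> (expectation (\<lambda>x. X x ^ (2 ^ m)) powr (1 / 2 ^ m))\<^sup>2"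
proof -
  obtain j where m: "m = Suc j" using \<open>1 \<le> m\<close> by (cases m) auto
  have pow: "X x ^ (2 ^ m) = (X x)\<^sup>2 ^ (2 ^ j)" for x by (simp add: m power_mult)
  note [measurable] = meas
  have *: "integrable M (\<lambda>x. (X x)\<^sup>2)"
    "expectation (\<lambda>x. (X x)\<^sup>2) ^ (2 ^ j) \<le> expectation (\<lambda>x. X x ^ (2 ^ m))"
    using power_expectation_le[of "\<lambda>x. (X x)\<^sup>2" j] int unfolding pow by auto
  show "integrable M (\<lambda>x. (X x)\<^sup>2)" by (rule *)
  define E where "E = expectation (\<lambda>x. X x ^ (2 ^ m))"
  have "0 \<le> E" unfolding E_def pow by (intro integral_nonneg_AE) auto
  have e0: "0 \<le> expectation (\<lambda>x. (X x)\<^sup>2)" by (intro integral_nonneg_AE) auto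
  have "(E powr (1 / 2 ^ m))\<^sup>2 = E powr (2 * (1 / 2 ^ m))"
    by (simp add: power2_eq_square flip: powr_add)
  also have "\<dots> = E powr (1 / 2 ^ j)" by (simp add: m)
  finally have sq: "(E powr (1 / 2 ^ m))\<^sup>2 = E powr (1 / 2 ^ j)" .
  have "((E powr (1 / 2 ^ m))\<^sup>2) ^ (2 ^ j) = E"
    unfolding sq using \<open>0 \<le> E\<close> by (cases "E = 0") (simp_all add: powr_power)
  with *(2) e0 show "expectation (\<lambda>x. (X x)\<^sup>2) \<le> (E powr (1 / 2 ^ m))\<^sup>2"
    unfolding E_def[symmetric]
    by (metis power_mono_iff zero_le_power2 zero_less_numeral zero_less_power)
qed

section \<open>Product measures, total expectation and independence\<close>

text \<open>Tonelli for null sets. The exceptional set of \<open>Q\<close> is covered by a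
  measurable null set \<open>Z\<close>, almost all of whose sections are null.\<close>

lemma (in product_sigma_finite) AE_PiM_insertD:
  assumes I: "finite I" "i \<notin> I" and AE: "AE s in PiM (insert i I) M. Q s"
  shows "AE s in PiM I M. AE y in M i. Q (s(i := y))"
proof -
  obtain Z where Z: "{s \<in> space (PiM (insert i I) M). \<not> Q s} \<subseteq> Z"
    "emeasure (PiM (insert i I) M) Z = 0" "Z \<in> sets (PiM (insert i I) M)"
    using AE by (rule AE_E)
  note [measurable] = Z(3)
  have "0 = (\<integral>\<^sup>+ s. indicator Z s \<partial>PiM (insert i I) M)" using Z(2,3) by simp
  also have "\<dots> = (\<integral>\<^sup>+ s. (\<integral>\<^sup>+ y. indicator Z (s(i := y)) \<partial>M i) \<partial>PiM I M)"
    by (intro product_nn_integral_insert I) simp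
  finally have "(\<integral>\<^sup>+ s. (\<integral>\<^sup>+ y. indicator Z (s(i := y)) \<partial>M i) \<partial>PiM I M) = 0" by simp
  moreover have "(\<lambda>s. \<integral>\<^sup>+ y. indicator Z (s(i := y)) \<partial>M i) \<in> borel_measurable (PiM I M)"
    by measurable
  ultimately have "AE s in PiM I M. (\<integral>\<^sup>+ y. indicator Z (s(i := y)) \<partial>M i) = 0"
    by (simp add: nn_integral_0_iff_AE)
  with AE_space show ?thesis
  proof eventually_elim
    case (elim s)
    note [measurable] = elim(1)
    have "AE y in M i. (indicator Z (s(i := y)) :: ennreal) = 0"
      using elim(2) by (subst (asm) nn_integral_0_iff_AE) measurable
    with AE_space show ?case
    proof eventually_elim
      case (elim y)
      have "s(i := y) \<in> space (PiM (insert i I) M)"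
        using \<open>s \<in> space (PiM I M)\<close> elim(1) by (auto simp: space_PiM PiE_iff extensional_def)
      with elim(2) Z(1) show ?case by (auto simp: indicator_def split: if_splits)
    qed
  qed
qed

text \<open>Tonelli, peeling off the innermost coordinate \<open>Suc n\<close> at each step.\<close>

lemma total_expectation_eq_nn_integral:
  assumes "prob_space P" and "X \<in> borel_measurable (PiM {1..n} (\<lambda>_. P))"
  shows "total_expectation P n X = (\<integral>\<^sup>+ s. X s \<partial>PiM {1..n} (\<lambda>_. P))"
proof -
  interpret P: prob_space P by fact
  interpret product_sigma_finite "\<lambda>_. P" ..
  show ?thesis
    using assms(2)
  proof (induction n arbitrary: X)
    case 0
    show ?case by (simp add: nn_integral_empty)
  next
    case (Suc n)
    have ins: "{1..Suc n} = insert (Suc n) {1..n}" by auto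
    have X [measurable]: "X \<in> borel_measurable (PiM (insert (Suc n) {1..n}) (\<lambda>_. P))"
      using Suc.prems by (simp only: ins)
    have "(\<lambda>s. \<integral>\<^sup>+ x. X (s(Suc n := x)) \<partial>P) \<in> borel_measurable (PiM {1..n} (\<lambda>_. P))"
      by measurable
    from Suc.IH[OF this] show ?case
      unfolding ins total_expectation.simps
      by (subst product_nn_integral_insert[OF _ _ X]) (simp_all only: finite_atLeastAtMost, simp)
  qed
qed

text \<open>Independence enters here: it moves the almost sure recursion to a product measure, where
  the newest sample can be integrated separately.\<close>

lemma joint_law_eq_PiM:
  assumes "prob_space M" and indep: "prob_space.indep_vars M (\<lambda>_. N) \<xi>s {1..}"
    and law: "\<forall>k\<ge>1. distr M N (\<xi>s k) = P" and "1 \<le> k"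
  shows "joint_law M N \<xi>s k = PiM {1..k} (\<lambda>_. P)"
proof -
  interpret prob_space M by fact
  have indep': "indep_vars (\<lambda>_. N) \<xi>s {1..k}"
    using indep by (rule indep_vars_subset) auto
  then have "random_variable N (\<xi>s i)" if "i \<in> {1..k}" for i
    using that by (auto simp: indep_vars_def)
  then have "joint_law M N \<xi>s k = PiM {1..k} (\<lambda>i. distr M N (\<xi>s i))"
    using indep_vars_iff_distr_eq_PiM'[where I = "{1..k}" and M' = "\<lambda>_. N" and X = \<xi>s]
      indep' \<open>1 \<le> k\<close>
    unfolding joint_law_def by auto
  also have "\<dots> = PiM {1..k} (\<lambda>_. P)"
    using law by (intro PiM_cong) auto
  finally show ?thesis .
qed

section \<open>Averaging one step over the newest sample\<close>

text \<open>With the past frozen, \<open>a\<close> is the squared old error and \<open>l\<close> the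
  centred cross term. The right-hand side of \<open>bound\<close> dominates a square, hence is
  almost everywhere nonnegative, and its nonnegative integral is its ordinary expectation.\<close>

lemma (in prob_space) nn_integral_step_bound:
  fixes c :: "'a \<Rightarrow> real" and g :: "'a \<Rightarrow> 'h::real_normed_vector" and l z :: "'a \<Rightarrow> real"
  assumes int: "integrable M c" "integrable M (\<lambda>x. (c x)\<^sup>2)" "integrable M (\<lambda>x. (norm (g x))\<^sup>2)"
      "integrable M l"
    and mean: "expectation l = 0" and "0 \<le> a"
    and bound: "AE x in M. (z x)\<^sup>2 \<le> (1 - 2 * (\<alpha> * c x) + 5 * (\<alpha> * c x)\<^sup>2) * a
      - 2 * \<alpha> * l x + 3 * \<alpha>\<^sup>2 * (norm (g x))\<^sup>2"
  shows "(\<integral>\<^sup>+ x. ennreal ((z x)\<^sup>2) \<partial>M) \<le>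
    ennreal ((1 - 2 * \<alpha> * expectation c + 5 * \<alpha>\<^sup>2 * expectation (\<lambda>x. (c x)\<^sup>2)) * a
      + 3 * \<alpha>\<^sup>2 * expectation (\<lambda>x. (norm (g x))\<^sup>2))"
proof -
  define h where "h x = (1 - 2 * \<alpha> * c x + 5 * \<alpha>\<^sup>2 * (c x)\<^sup>2) * a
      - 2 * \<alpha> * l x + 3 * \<alpha>\<^sup>2 * (norm (g x))\<^sup>2" for x
  have le: "AE x in M. (z x)\<^sup>2 \<le> h x"
    using bound by (simp add: h_def power_mult_distrib mult.assoc)
  then have "AE x in M. 0 \<le> h x"
    by eventually_elim (rule order_trans[OF zero_le_power2])
  moreover have "integrable M h" unfolding h_def using int by auto
  moreover have "(\<integral>\<^sup>+ x. ennreal ((z x)\<^sup>2) \<partial>M) \<le> (\<integral>\<^sup>+ x. ennreal (h x) \<partial>M)"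
    using le by (intro nn_integral_mono_AE) (auto simp: ennreal_leI)
  ultimately have "(\<integral>\<^sup>+ x. ennreal ((z x)\<^sup>2) \<partial>M) \<le> ennreal (expectation h)"
    by (simp add: nn_integral_eq_integral)
  also have "expectation h = (1 - 2 * \<alpha> * expectation c + 5 * \<alpha>\<^sup>2 * expectation (\<lambda>x. (c x)\<^sup>2)) * a
      + 3 * \<alpha>\<^sup>2 * expectation (\<lambda>x. (norm (g x))\<^sup>2)"
    unfolding h_def using int mean by (simp add: prob_space)
  finally show ?thesis .
qed

section \<open>Sublinear convergence of the stochastic proximal iteration\<close>

theorem theorem2p1:
  shows "\<exists>C :: real \<Rightarrow> real \<Rightarrow> real \<Rightarrow> real \<Rightarrow> real \<Rightarrow> nat \<Rightarrow> real.
    \<forall>(M :: 'w measure) (N :: 's measure) (\<xi> :: 'w \<Rightarrow> 's) (\<xi>s :: nat \<Rightarrow> 'w \<Rightarrow> 's)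
      (f :: 'h::{real_inner, complete_space} \<Rightarrow> 's \<Rightarrow> ereal) (grad :: 'h \<Rightarrow> 's \<Rightarrow> ('h \<Rightarrow>\<^sub>L real))
      (D :: 'h set) (wstar :: 'h) (m :: nat) (\<sigma> :: real) (\<mu> :: real) (\<nu> :: real)
      (\<eta> :: real) (w1 :: 'h) (w :: nat \<Rightarrow> (nat \<Rightarrow> 's) \<Rightarrow> 'h).
      prob_space M \<longrightarrow> complete_measure M \<longrightarrow>
      \<xi> \<in> measurable M N \<longrightarrow>
      assumption1 (distr M N \<xi>) f grad D wstar m \<sigma> \<mu> \<nu> \<longrightarrow>
      minimizer_conventions (distr M N \<xi>) f grad D wstar \<longrightarrow>
      prob_space.indep_vars M (\<lambda>_. N) \<xi>s {1..} \<longrightarrow>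
      (\<forall>k\<ge>1. distr M N (\<xi>s k) = distr M N \<xi>) \<longrightarrow>
      \<eta> > 1 / \<mu> \<longrightarrow>
      stochastic_proximal_iteration M N \<xi>s grad D (\<lambda>k. \<eta> / real k) w1 w \<longrightarrow>
      (\<forall>k\<ge>1. total_expectation (distr M N \<xi>) (k - 1)
                 (\<lambda>s. ennreal ((norm (w k s - wstar))\<^sup>2))
               \<le> ennreal (C (norm (w1 - wstar)) \<mu> \<nu> \<sigma> \<eta> m / real k))"
\<comment> \<open>The function \<open>C\<close> is fixed before all other data. Its arguments come
  from \<open>\<alpha> = \<eta> / k\<close>, which turns the one-step factor into
  \<open>1 - 2c / k + A / k^2\<close> with \<open>c = \<eta> \<mu>\<close>,
  \<open>A = 5 \<eta>^2 \<nu>^2\<close>, and the noise into \<open>B / k^2\<close> with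
  \<open>B = 3 \<eta>^2 \<sigma>^2\<close>.\<close>
proof (rule exI[of _ "\<lambda>r \<mu> \<nu> \<sigma> \<eta> m. rate_constant (\<eta> * \<mu>) (5 * \<eta>\<^sup>2 * \<nu>\<^sup>2) (3 * \<eta>\<^sup>2 * \<sigma>\<^sup>2) (r\<^sup>2)"],
    intro allI impI)
  fix M :: "'w measure" and N :: "'s measure" and \<xi> :: "'w \<Rightarrow> 's" and \<xi>s :: "nat \<Rightarrow> 'w \<Rightarrow> 's"
    and f :: "'h \<Rightarrow> 's \<Rightarrow> ereal" and grad :: "'h \<Rightarrow> 's \<Rightarrow> ('h \<Rightarrow>\<^sub>L real)"
    and D :: "'h set" and wstar :: 'h and m :: nat and \<sigma> \<mu> \<nu> \<eta> :: real and w1 :: 'h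
    and w :: "nat \<Rightarrow> (nat \<Rightarrow> 's) \<Rightarrow> 'h" and k :: nat
  assume M: "prob_space M" and \<xi>: "\<xi> \<in> measurable M N"
    and assm1: "assumption1 (distr M N \<xi>) f grad D wstar m \<sigma> \<mu> \<nu>"
    and minim: "minimizer_conventions (distr M N \<xi>) f grad D wstar"
    and indep: "prob_space.indep_vars M (\<lambda>_. N) \<xi>s {1..}"
    and law: "\<forall>k\<ge>1. distr M N (\<xi>s k) = distr M N \<xi>"
    and \<eta>: "\<eta> > 1 / \<mu>"
    and iter: "stochastic_proximal_iteration M N \<xi>s grad D (\<lambda>k. \<eta> / real k) w1 w"
    and "1 \<le> k"
  define P where "P = distr M N \<xi>"
  interpret P: prob_space P
    unfolding P_def using M \<xi> by (rule prob_space.prob_space_distr)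
  interpret product_sigma_finite "\<lambda>_. P" ..
  let ?Pi = "\<lambda>I. PiM I (\<lambda>_. P)"
  let ?e = "\<lambda>k s. w k s - wstar"
  have Pi: "prob_space (?Pi I)" for I :: "nat set"
    by (intro prob_space_PiM P.prob_space_axioms)

  have wstar: "wstar \<in> D" using minim by (simp add: minimizer_conventions_def)
  have mean0: "integrable P (\<lambda>x. blinfun_apply (grad wstar x) v)"
    "(\<integral>x. blinfun_apply (grad wstar x) v \<partial>P) = 0" for v
  proof -
    obtain gradF :: "'h \<Rightarrow> ('h \<Rightarrow>\<^sub>L real)" where "gradF wstar = 0"
      "\<And>u v. u \<in> D \<Longrightarrow> integrable P (\<lambda>x. blinfun_apply (grad u x) v) \<and>
         blinfun_apply (gradF u) v = (\<integral>x. blinfun_apply (grad u x) v \<partial>P)"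
      using minim unfolding minimizer_conventions_def P_def[symmetric] by blast
    from this(1) this(2)[OF wstar, of v] show "integrable P (\<lambda>x. blinfun_apply (grad wstar x) v)"
      "(\<integral>x. blinfun_apply (grad wstar x) v \<partial>P) = 0"
      by auto
  qed
  have "1 \<le> m" and "grad wstar \<in> borel_measurable P"
    and "integrable P (\<lambda>x. norm (grad wstar x) ^ (2 ^ m))"
    and \<sigma>: "\<sigma> = (\<integral>x. norm (grad wstar x) ^ (2 ^ m) \<partial>P) powr (1 / 2 ^ m)"
    using assm1 wstar unfolding assumption1_def P_def[symmetric] by simp_all
  then have G: "integrable P (\<lambda>x. (norm (grad wstar x))\<^sup>2)"
    "(\<integral>x. (norm (grad wstar x))\<^sup>2 \<partial>P) \<le> \<sigma>\<^sup>2"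
    using P.second_moment_le[of "\<lambda>x. norm (grad wstar x)" m] by auto
  obtain Mop :: "'s \<Rightarrow> ('h \<Rightarrow>\<^sub>L 'h)" and mu :: "'s \<Rightarrow> real" where
    mu: "\<And>x. x \<in> space P \<Longrightarrow> 0 \<le> mu x" "integrable P mu" "(\<integral>x. mu x \<partial>P) = \<mu>" "0 < \<mu>"
      "integrable P (\<lambda>x. (mu x)\<^sup>2)" "(\<integral>x. (mu x)\<^sup>2 \<partial>P) = \<nu>\<^sup>2" and
    Mop: "AE x in P. \<forall>u\<in>D. \<forall>v\<in>D.
       blinfun_apply (grad u x - grad v x) (u - v)
         \<ge> inner (blinfun_apply (Mop x) (u - v)) (u - v) \<and>
       inner (blinfun_apply (Mop x) (u - v)) (u - v) \<ge> mu x * (norm (u - v))\<^sup>2"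
    using assm1 unfolding assumption1_def P_def[symmetric] by blast
  \<comment> \<open>Chaining both inequalities through \<open>Mop x\<close>, with
    \<open>wstar\<close> as second point, leaves strong monotonicity with the random modulus
    \<open>mu x\<close>.\<close>
  from Mop have mono: "AE x in P. \<forall>u\<in>D. mu x * (norm (u - wstar))\<^sup>2
      \<le> inner (riesz (grad u x) - riesz (grad wstar x)) (u - wstar)"
  proof eventually_elim
    case (elim x)
    then show ?case
      using wstar by (metis (no_types, lifting) inner_riesz order_trans riesz_diff)
  qed

  define c where "c = \<eta> * \<mu>"
  define A where "A = 5 * \<eta>\<^sup>2 * \<nu>\<^sup>2"
  define B where "B = 3 * \<eta>\<^sup>2 * \<sigma>\<^sup>2"
  have "1 < c" using \<eta> \<open>0 < \<mu>\<close> by (simp add: c_def field_simps)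
  have "0 < \<eta>" using \<eta> \<open>0 < \<mu>\<close> by (meson less_trans zero_less_divide_1_iff)
  have "0 \<le> A" "0 \<le> B" by (auto simp: A_def B_def)
  have coeff_eq: "1 - 2 * (\<eta> / k) * \<mu> + 5 * (\<eta> / k)\<^sup>2 * \<nu>\<^sup>2 = 1 - 2 * c / k + A / k\<^sup>2" for k :: nat
    by (simp add: c_def A_def power_divide)
  \<comment> \<open>The factor is the expectation of \<open>1 - 2t + 5t^2 = (1 - t)^2 + 4t^2\<close>
    at \<open>t = (\<eta> / k) mu x\<close>, hence nonnegative even for large early steps.\<close>
  have coeff: "0 \<le> 1 - 2 * c / k + A / k\<^sup>2" for k :: nat
  proof -
    have "(\<integral>x. 1 - 2 * (\<eta> / k) * mu x + 5 * (\<eta> / k)\<^sup>2 * (mu x)\<^sup>2 \<partial>P) = 1 - 2 * c / k + A / k\<^sup>2"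
      unfolding coeff_eq[symmetric] using mu by (simp add: P.prob_space)
    moreover have "0 \<le> 1 - 2 * (\<eta> / k) * mu x + 5 * (\<eta> / k)\<^sup>2 * (mu x)\<^sup>2" for x
    proof -
      have "1 - 2 * (\<eta> / k) * mu x + 5 * (\<eta> / k)\<^sup>2 * (mu x)\<^sup>2
          = (1 - \<eta> / k * mu x)\<^sup>2 + 4 * (\<eta> / k * mu x)\<^sup>2"
        by (simp add: power2_eq_square algebra_simps)
      then show ?thesis by simp
    qed
    ultimately show ?thesis using integral_nonneg_AE by (metis (mono_tags, lifting) AE_I2)
  qed

  have w_meas: "w k \<in> borel_measurable (?Pi {1..<k})" if "1 \<le> k" for k
  proof -
    have "w k \<in> borel_measurable (PiM {1..<k} (\<lambda>_. N))"
      using iter that by (simp add: stochastic_proximal_iteration_def)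
    moreover have "sets (?Pi {1..<k}) = sets (PiM {1..<k} (\<lambda>_. N))"
      by (rule sets_PiM_cong) (auto simp: P_def)
    ultimately show ?thesis using measurable_cong_sets by blast
  qed
  have err_meas: "(\<lambda>s. ennreal ((norm (?e k s))\<^sup>2)) \<in> borel_measurable (?Pi {1..<k})"
    if "1 \<le> k" for k
  proof -
    have "(\<lambda>v. ennreal ((norm (v - wstar))\<^sup>2)) \<in> borel_measurable borel"
      by (intro measurable_compose[OF _ measurable_ennreal] borel_measurable_continuous_onI
          continuous_intros)
    from measurable_compose[OF w_meas[OF that] this] show ?thesis .
  qed

  \<comment> \<open>The pairing of \<open>grad wstar (s k)\<close> with \<open>w k s\<close> need not be jointly measurable, since \<open>'h\<close> may
    be nonseparable; hence \<open>s k\<close> is integrated out first, for fixed earlier samples.\<close>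
  have one_step: "(\<integral>\<^sup>+ s. ennreal ((norm (?e (Suc k) s))\<^sup>2) \<partial>?Pi {1..<Suc k})
      \<le> ennreal (1 - 2 * c / k + A / k\<^sup>2) * (\<integral>\<^sup>+ s. ennreal ((norm (?e k s))\<^sup>2) \<partial>?Pi {1..<k})
        + ennreal (B / k\<^sup>2)"
    if "1 \<le> k" for k
  proof -
    have ins: "{1..k} = insert k {1..<k}" "{1..<Suc k} = insert k {1..<k}" using that by auto
    have upd: "AE s in ?Pi (insert k {1..<k}). w (Suc k) s \<in> D \<and>
        w (Suc k) s = w k (restrict s {1..<k}) - (\<eta> / k) *\<^sub>R riesz (grad (w (Suc k) s) (s k))"
      using iter that
      unfolding stochastic_proximal_iteration_def ins(1)[symmetric] P_def
        joint_law_eq_PiM[OF M indep law that, symmetric] by blast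
    have AE: "AE s in ?Pi {1..<k}. AE x in P. w (Suc k) (s(k := x)) \<in> D \<and>
        w (Suc k) (s(k := x)) = w k (restrict (s(k := x)) {1..<k})
          - (\<eta> / k) *\<^sub>R riesz (grad (w (Suc k) (s(k := x))) ((s(k := x)) k))"
      by (rule AE_PiM_insertD[OF _ _ upd]) simp_all
    have "(\<integral>\<^sup>+ s. ennreal ((norm (?e (Suc k) s))\<^sup>2) \<partial>?Pi {1..<Suc k})
        = (\<integral>\<^sup>+ s. (\<integral>\<^sup>+ x. ennreal ((norm (?e (Suc k) (s(k := x))))\<^sup>2) \<partial>P) \<partial>?Pi {1..<k})"
      unfolding ins(2) using err_meas[of "Suc k"] unfolding ins(2)
      by (subst product_nn_integral_insert) auto
    also have "\<dots> \<le> (\<integral>\<^sup>+ s. ennreal ((1 - 2 * c / k + A / k\<^sup>2) * (norm (?e k s))\<^sup>2 + B / k\<^sup>2)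
        \<partial>?Pi {1..<k})"
    proof (rule nn_integral_mono_AE)
      show "AE s in ?Pi {1..<k}. (\<integral>\<^sup>+ x. ennreal ((norm (?e (Suc k) (s(k := x))))\<^sup>2) \<partial>P)
        \<le> ennreal ((1 - 2 * c / k + A / k\<^sup>2) * (norm (?e k s))\<^sup>2 + B / k\<^sup>2)"
        using AE AE_space
      proof eventually_elim
        case (elim s)
        \<comment> \<open>The previous iterate sees only earlier samples, so its error is constant
          while \<open>x\<close> is integrated out; this is why the cross term averages to
          zero.\<close>
        have restr: "restrict (s(k := x)) {1..<k} = s" for x
          using elim(2) by (auto simp: space_PiM PiE_iff extensional_def restrict_def fun_eq_iff)
        have "AE x in P. (norm (?e (Suc k) (s(k := x))))\<^sup>2 \<le>
          (1 - 2 * (\<eta> / k * mu x) + 5 * (\<eta> / k * mu x)\<^sup>2) * (norm (?e k s))\<^sup>2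
          - 2 * (\<eta> / k) * blinfun_apply (grad wstar x) (?e k s)
          + 3 * (\<eta> / k)\<^sup>2 * (norm (grad wstar x))\<^sup>2"
          using elim(1) mono AE_space
        proof eventually_elim
          case (elim x)
          let ?w = "w (Suc k) (s(k := x))"
          let ?g = "riesz (grad wstar x)"
          \<comment> \<open>Adding and subtracting \<open>?g\<close> isolates the gradient
            difference, which \<open>mono\<close> controls, from the noise at the minimizer.\<close>
          have step: "?w - wstar = (w k s - wstar) - (\<eta> / k) *\<^sub>R ((riesz (grad ?w x) - ?g) + ?g)"
            using elim(1) restr[of x] by auto
          have "(norm (?w - wstar))\<^sup>2
              \<le> (1 - 2 * (\<eta> / k * mu x) + 5 * (\<eta> / k * mu x)\<^sup>2) * (norm (?e k s))\<^sup>2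
                - 2 * (\<eta> / k) * inner ?g (?e k s) + 3 * (\<eta> / k)\<^sup>2 * (norm ?g)\<^sup>2"
            using elim mu(1) \<open>0 < \<eta>\<close> by (intro implicit_step_bound[OF step]) auto
          also have "\<dots> \<le> (1 - 2 * (\<eta> / k * mu x) + 5 * (\<eta> / k * mu x)\<^sup>2) * (norm (?e k s))\<^sup>2
                - 2 * (\<eta> / k) * blinfun_apply (grad wstar x) (?e k s)
                + 3 * (\<eta> / k)\<^sup>2 * (norm (grad wstar x))\<^sup>2"
            unfolding inner_riesz using norm_riesz_le[of "grad wstar x"]
            by (intro add_left_mono mult_left_mono power_mono) auto
          finally show ?case .
        qed
        from P.nn_integral_step_bound[OF mu(2,5) G(1) mean0 _ this]
        have "(\<integral>\<^sup>+ x. ennreal ((norm (?e (Suc k) (s(k := x))))\<^sup>2) \<partial>P)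
            \<le> ennreal ((1 - 2 * c / k + A / k\<^sup>2) * (norm (?e k s))\<^sup>2
              + 3 * (\<eta> / k)\<^sup>2 * (\<integral>x. (norm (grad wstar x))\<^sup>2 \<partial>P))"
          using mu(3,6) by (simp only: coeff_eq) simp
        also have "\<dots> \<le> ennreal ((1 - 2 * c / k + A / k\<^sup>2) * (norm (?e k s))\<^sup>2
              + 3 * (\<eta> / k)\<^sup>2 * \<sigma>\<^sup>2)"
          using G(2) by (intro ennreal_leI add_left_mono mult_left_mono) auto
        also have "3 * (\<eta> / k)\<^sup>2 * \<sigma>\<^sup>2 = B / k\<^sup>2" by (simp add: B_def power_divide)
        finally show ?case .
      qed
    qed
    also have "\<dots> = (\<integral>\<^sup>+ s. ennreal (1 - 2 * c / k + A / k\<^sup>2) * ennreal ((norm (?e k s))\<^sup>2)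
        + ennreal (B / k\<^sup>2) \<partial>?Pi {1..<k})"
      using coeff[of k] \<open>0 \<le> B\<close> by (simp add: ennreal_plus ennreal_mult)
    also have "\<dots> = ennreal (1 - 2 * c / k + A / k\<^sup>2)
        * (\<integral>\<^sup>+ s. ennreal ((norm (?e k s))\<^sup>2) \<partial>?Pi {1..<k}) + ennreal (B / k\<^sup>2)"
      using err_meas[OF that] prob_space.emeasure_space_1[OF Pi]
      by (simp add: nn_integral_add nn_integral_cmult)
    finally show ?thesis .
  qed

  \<comment> \<open>A real comparison sequence: bounding the \<open>ennreal\<close> errors by it
    also yields their finiteness. Index 0 is a dummy that places the initial squared error at index
    1.\<close>
  define b where "b = rec_nat 0 (\<lambda>k t. if k = 0 then (norm (w1 - wstar))\<^sup>2
      else (1 - 2 * c / k + A / k\<^sup>2) * t + B / k\<^sup>2)"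
  have b1: "b 1 = (norm (w1 - wstar))\<^sup>2" by (simp add: b_def)
  have b_Suc: "b (Suc k) = (1 - 2 * c / k + A / k\<^sup>2) * b k + B / k\<^sup>2" if "1 \<le> k" for k
    using that by (simp add: b_def)
  have b_nonneg: "0 \<le> b k" if "1 \<le> k" for k
    using that
  proof (induction k rule: dec_induct)
    case base
    show ?case by (simp only: b1 zero_le_power2)
  next
    case (step n)
    then show ?case using coeff[of n] \<open>0 \<le> B\<close> by (simp add: b_Suc)
  qed
  have err_le: "(\<integral>\<^sup>+ s. ennreal ((norm (?e k s))\<^sup>2) \<partial>?Pi {1..<k}) \<le> ennreal (b k)"
    if "1 \<le> k" for k
    using that
  proof (induction k rule: dec_induct)
    case base
    \<comment> \<open>For \<open>k = 1\<close> no sample has been drawn: the product space over the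
      empty index set has the single point \<open>\<lambda>_. undefined\<close>.\<close>
    have "w 1 (\<lambda>_. undefined) = w1"
      using iter by (simp add: stochastic_proximal_iteration_def space_PiM)
    then show ?case using b1 by (simp add: nn_integral_empty)
  next
    case (step n)
    have "(\<integral>\<^sup>+ s. ennreal ((norm (?e (Suc n) s))\<^sup>2) \<partial>?Pi {1..<Suc n})
        \<le> ennreal (1 - 2 * c / n + A / n\<^sup>2) * ennreal (b n) + ennreal (B / n\<^sup>2)"
      using step by (intro order_trans[OF one_step] add_right_mono mult_left_mono) auto
    also have "\<dots> = ennreal (b (Suc n))"
      using step coeff[of n] b_nonneg[of n] \<open>0 \<le> B\<close>
      by (simp add: b_Suc ennreal_plus ennreal_mult)
    finally show ?case .
  qed

  have ivl: "{1..k - 1} = {1..<k}" using \<open>1 \<le> k\<close> by auto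
  have "total_expectation P (k - 1) (\<lambda>s. ennreal ((norm (w k s - wstar))\<^sup>2))
      = (\<integral>\<^sup>+ s. ennreal ((norm (?e k s))\<^sup>2) \<partial>?Pi {1..<k})"
    using err_meas[OF \<open>1 \<le> k\<close>]
    by (subst total_expectation_eq_nn_integral[OF P.prob_space_axioms]) (simp_all only: ivl)
  also have "\<dots> \<le> ennreal (b k)" using \<open>1 \<le> k\<close> by (rule err_le)
  also have "\<dots> \<le> ennreal (rate_constant c A B (b 1) / k)"
    using \<open>1 < c\<close> \<open>0 \<le> A\<close> \<open>0 \<le> B\<close> b_nonneg coeff b_Suc \<open>1 \<le> k\<close>
    by (intro ennreal_leI recursion_rate) auto
  finally show "total_expectation (distr M N \<xi>) (k - 1) (\<lambda>s. ennreal ((norm (w k s - wstar))\<^sup>2))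
      \<le> ennreal (rate_constant (\<eta> * \<mu>) (5 * \<eta>\<^sup>2 * \<nu>\<^sup>2) (3 * \<eta>\<^sup>2 * \<sigma>\<^sup>2)
          ((norm (w1 - wstar))\<^sup>2) / real k)"
    by (simp only: b1 P_def c_def A_def B_def)
qed

end
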